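(* Let $b^{*}>0$, let $f:I\subset[0,b^{*}]\to\mathbb{R}$ be a differentiable function on $I^{\circ}$ such that $f'''\in L[a,b]$, where $a,b\in I$ with $a<b$. Let $q\ge 1$. If $|f'''|^{q}$ is $m$-convex on $[a,b]$ for $m\in(0,1]$, then $$\left|\int_{a}^{mb}f(x)\,dx-\frac{mb-a}{6}\left[f(a)+4f\left(\frac{a+b}{2}\right)+f(mb)\right]\right|$$ $$\le\frac{(mb-a)^{4}}{1152}\left\{\left(\frac{3|f'''(a)|^{q}+7m|f'''(b)|^{q}}{10}\right)^{\frac1q}+\left(\frac{7|f'''(a)|^{q}+3m|f'''(b)|^{q}}{10}\right)^{\frac1q}\right\}.$$
   Context: $I$ is an interval and $I^{\circ}$ is its interior; $L[a,b]$ denotes the space of integrable functions on $[a,b]$. $m$-convexity (Toader): for $m\in[0,1]$, a function $g:[0,b]\to\mathbb{R}$ is said to be $m$-convex if $g(tx+m(1-t)y)\le t\,g(x)+m(1-t)\,g(y)$ for every $x,y\in[0,b]$ and $t\in[0,1]$. "$m$-convex on $[a,b]$" refers to this inequality for $x,y\in[a,b]$ and $t\in[0,1]$.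
   Formalization: The node f((a+b)/2) is corrected to f((a+mb)/2), since the printed inequality fails for f(x)=x, a=1, b=2, m=3/4; mb is assumed to lie in I, and the three derivatives are assumed to exist (one-sided at endpoints of I) also at a, b and mb. *)

theory Defs
  imports "HOL-Analysis.Analysis"
begin

text \<open>
  Toader's \<open>m\<close>-convexity, with the two points ranging over \<open>S\<close>. For \<open>S = {a..b}\<close> with \<open>a > 0\<close> and
  \<open>m < 1\<close>, the argument \<open>t * x + m * (1 - t) * y\<close> need not lie in \<open>S\<close>: it ranges over \<open>{m * a..b}\<close>.
\<close>

definition m_convex_on :: "real \<Rightarrow> real set \<Rightarrow> (real \<Rightarrow> real) \<Rightarrow> bool" where
  "m_convex_on m S g \<longleftrightarrow>
     (\<forall>x\<in>S. \<forall>y\<in>S. \<forall>t\<in>{0..1}.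
        g (t * x + m * (1 - t) * y) \<le> t * g x + m * (1 - t) * g y)"

end

theory Submission
  imports Defs
begin

text \<open>
  The error of Simpson's rule is an integral of \<open>f'''\<close> against a Peano kernel. On \<open>[u, v]\<close> with
  midpoint \<open>w\<close> this kernel is \<open>(x - u)\<^sup>2 (x - w) / 6\<close> on the left half, and
  \<open>(x - v)\<^sup>2 (x - w) / 6\<close> on the right half. The terms in \<open>f' w\<close> that the two halves produce
  cancel, so it is enough to bound one half-rule corrected by such a term
  (\<open>corrected_half_simpson_bound\<close>).

  On the segment from \<open>a\<close> to \<open>m * b\<close>, \<open>m\<close>-convexity applied to the points \<open>a\<close> and \<open>b\<close> says that
  \<open>\<bar>f'''\<bar> powr q\<close> lies below the chord with end values \<open>A = \<bar>f''' a\<bar> powr q\<close> and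
  \<open>B = m * \<bar>f''' b\<bar> powr q\<close>. The mean of that chord, weighted by the kernel over one half, is
  \<open>(7 A + 3 B) / 10\<close> or \<open>(3 A + 7 B) / 10\<close>. The usual argument now applies the power mean
  inequality. Here that inequality is replaced by its pointwise source: the concave function
  \<open>s \<mapsto> s powr (1 / q)\<close> lies below its tangent at the weighted mean (\<open>powr_le_tangent\<close>). So
  \<open>\<bar>f'''\<bar>\<close> is bounded by an affine function on each half, and the integral of an affine function
  against the kernel is explicit (\<open>peano_kernel_bound\<close>). As the tangent touches at the weighted
  mean, the result is exactly the root of that mean.

  The number \<open>m * b\<close> may lie on either side of \<open>a\<close>. For this reason the integral of \<open>f\<close> appears
  as the increment of an antiderivative \<open>F\<close>, and all estimates are made on a segment traversed in
  either direction.
\<close>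

text \<open>
  The right-hand side is the tangent of the concave function \<open>s \<mapsto> s powr r\<close> at \<open>c\<close>, in the form
  that Young's inequality \<open>s powr r * c powr (1 - r) \<le> r * s + (1 - r) * c\<close> gives after division.
\<close>

lemma powr_le_tangent:
  fixes s c r :: real
  assumes "0 \<le> s" "0 < c" "0 < r" "r \<le> 1"
  shows "s powr r \<le> c powr (r - 1) * (r * s + (1 - r) * c)"
proof (cases "s = 0")
  case True
  then show ?thesis using assms by simp
next
  case False
  with assms have "s powr r * c powr (1 - r) \<le> r * s + (1 - r) * c"
    by (intro Youngs_inequality_0) auto
  then have "c powr (r - 1) * (s powr r * c powr (1 - r)) \<le> c powr (r - 1) * (r * s + (1 - r) * c)"
    by (rule mult_left_mono) simp
  moreover have "c powr (r - 1) * (s powr r * c powr (1 - r)) = s powr r * c powr ((r - 1) + (1 - r))"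
    by (simp only: powr_add mult.commute mult.left_commute)
  ultimately show ?thesis using assms by simp
qed

text \<open>
  With the kernel \<open>p t = t\<^sup>2 (t - 1) / 6\<close>, which has \<open>p''' = 1\<close>, the function
  \<open>H = p g'' - p' g' + p'' g - G\<close> has derivative \<open>p g'''\<close>. The double zero of \<open>p\<close> at \<open>0\<close> removes
  \<open>g' 0\<close> from the boundary terms, and \<open>\<bar>p\<bar>\<close> has integral \<open>1 / 72\<close> and first moment \<open>1 / 120\<close>.
\<close>

lemma peano_kernel_bound:
  fixes G g g' g'' g''' :: "real \<Rightarrow> real"
  assumes G: "\<And>t. t \<in> {0..1} \<Longrightarrow> (G has_real_derivative g t) (at t within {0..1})"
    and g: "\<And>t. t \<in> {0..1} \<Longrightarrow> (g has_real_derivative g' t) (at t within {0..1})"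
    and g': "\<And>t. t \<in> {0..1} \<Longrightarrow> (g' has_real_derivative g'' t) (at t within {0..1})"
    and g'': "\<And>t. t \<in> {0..1} \<Longrightarrow> (g'' has_real_derivative g''' t) (at t within {0..1})"
    and bound: "\<And>t. t \<in> {0..1} \<Longrightarrow> \<bar>g''' t\<bar> \<le> \<alpha> + \<beta> * t"
  shows "\<bar>G 1 - G 0 - (2 / 3 * g 1 + 1 / 3 * g 0 - g' 1 / 6)\<bar> \<le> \<alpha> / 72 + \<beta> / 120"
proof -
  define p where "p = (\<lambda>t::real. t\<^sup>2 * (t - 1) / 6)"
  define H where "H = (\<lambda>t. p t * g'' t - (3 * t\<^sup>2 - 2 * t) / 6 * g' t + (t - 1 / 3) * g t - G t)"
  \<comment> \<open>An antiderivative of the bound \<open>\<bar>p t\<bar> * (\<alpha> + \<beta> * t)\<close> for the integrand.\<close>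
  define Q where "Q = (\<lambda>t::real. \<alpha> * (t ^ 3 / 18 - t ^ 4 / 24) + \<beta> * (t ^ 4 / 24 - t ^ 5 / 30))"
  have "((\<lambda>t. p t * g''' t) has_integral (H 1 - H 0)) {0..1}"
  proof (rule fundamental_theorem_of_calculus)
    fix t :: real assume t: "t \<in> {0..1}"
    have "(H has_real_derivative p t * g''' t) (at t within {0..1})"
      unfolding H_def p_def
      by (auto intro!: derivative_eq_intros G[OF t] g[OF t] g'[OF t] g''[OF t]
          simp: field_simps power2_eq_square)
    then show "(H has_vector_derivative p t * g''' t) (at t within {0..1})"
      by (simp add: has_real_derivative_iff_has_vector_derivative)
  qed simp
  moreover have "((\<lambda>t. t\<^sup>2 * (1 - t) / 6 * (\<alpha> + \<beta> * t)) has_integral (Q 1 - Q 0)) {0..1}"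
  proof (rule fundamental_theorem_of_calculus)
    fix t :: real
    have "(Q has_real_derivative t\<^sup>2 * (1 - t) / 6 * (\<alpha> + \<beta> * t)) (at t within {0..1})"
      unfolding Q_def
      by (auto intro!: derivative_eq_intros simp: field_simps eval_nat_numeral)
    then show "(Q has_vector_derivative t\<^sup>2 * (1 - t) / 6 * (\<alpha> + \<beta> * t)) (at t within {0..1})"
      by (simp add: has_real_derivative_iff_has_vector_derivative)
  qed simp
  moreover have "norm (p t * g''' t) \<le> t\<^sup>2 * (1 - t) / 6 * (\<alpha> + \<beta> * t)" if "t \<in> {0..1}" for t
  proof -
    have "\<bar>p t\<bar> = t\<^sup>2 * (1 - t) / 6" using that by (simp add: p_def abs_mult)
    moreover have "t\<^sup>2 * (1 - t) / 6 * \<bar>g''' t\<bar> \<le> t\<^sup>2 * (1 - t) / 6 * (\<alpha> + \<beta> * t)"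
      using that by (intro mult_left_mono bound) auto
    ultimately show ?thesis by (simp only: real_norm_def abs_mult)
  qed
  ultimately have "norm (H 1 - H 0) \<le> Q 1 - Q 0"
    by (metis (lifting) has_integral_integrable_integral integral_norm_bound_integral)
  then show ?thesis by (simp add: H_def Q_def p_def abs_minus_commute algebra_simps)
qed

text \<open>
  One half of Simpson's rule, from the endpoint \<open>e\<close> to the midpoint \<open>w\<close>. The correction is even in
  \<open>w - e\<close>, whereas \<open>F w - F e\<close> changes sign with the direction; this is what makes the corrections
  cancel when the halves from both endpoints are subtracted. The estimate follows from
  \<open>peano_kernel_bound\<close> after the affine substitution that maps \<open>[0, 1]\<close> to the segment. The kernel
  there has the weighted mean point \<open>72 / 120 = 3 / 5\<close>, which explains the weights of \<open>C\<close> and \<open>D\<close>.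
\<close>

lemma corrected_half_simpson_bound:
  fixes F f f' f'' f''' :: "real \<Rightarrow> real" and e w C D q :: real
  assumes F: "\<And>x. x \<in> closed_segment e w \<Longrightarrow> (F has_real_derivative f x) (at x within closed_segment e w)"
    and f: "\<And>x. x \<in> closed_segment e w \<Longrightarrow> (f has_real_derivative f' x) (at x within closed_segment e w)"
    and f': "\<And>x. x \<in> closed_segment e w \<Longrightarrow> (f' has_real_derivative f'' x) (at x within closed_segment e w)"
    and f'': "\<And>x. x \<in> closed_segment e w \<Longrightarrow> (f'' has_real_derivative f''' x) (at x within closed_segment e w)"
    and "q \<ge> 1" "C \<ge> 0" "D \<ge> 0"
    and bound: "\<And>t. t \<in> {0..1} \<Longrightarrow> \<bar>f''' (e + (w - e) * t)\<bar> powr q \<le> (1 - t) * C + t * D"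
  shows "\<bar>F w - F e - ((w - e) * (2 / 3 * f w + 1 / 3 * f e) - (w - e)\<^sup>2 * f' w / 6)\<bar>
         \<le> (w - e) ^ 4 / 72 * ((2 * C + 3 * D) / 5) powr (1 / q)"
proof -
  define d where "d = w - e"
  define \<phi> where "\<phi> = (\<lambda>t. e + d * t)"
  define r where "r = 1 / q"
  define c where "c = (2 * C + 3 * D) / 5"
  have r: "0 < r" "r \<le> 1" using \<open>q \<ge> 1\<close> by (auto simp: r_def)
  have \<phi>: "\<phi> ` {0..1} = closed_segment e w"
    unfolding closed_segment_image_interval \<phi>_def d_def
    by (intro image_cong refl) (simp add: algebra_simps)
  have chain: "((\<lambda>t. k * h (\<phi> t)) has_real_derivative k * d * h' (\<phi> t)) (at t within {0..1})"
    if "\<And>x. x \<in> closed_segment e w \<Longrightarrow> (h has_real_derivative h' x) (at x within closed_segment e w)"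
       "t \<in> {0..1}" for h h' k t
  proof -
    have "\<phi> t \<in> closed_segment e w" using \<phi> that(2) by blast
    then have "(h has_real_derivative h' (\<phi> t)) (at (\<phi> t) within \<phi> ` {0..1})"
      using that(1) by (simp add: \<phi>)
    moreover have "(\<phi> has_real_derivative d) (at t within {0..1})"
      unfolding \<phi>_def by (auto intro!: derivative_eq_intros)
    ultimately have "((h \<circ> \<phi>) has_real_derivative h' (\<phi> t) * d) (at t within {0..1})"
      by (rule DERIV_image_chain)
    then have "((\<lambda>t. k * (h \<circ> \<phi>) t) has_real_derivative k * (h' (\<phi> t) * d)) (at t within {0..1})"
      by (rule DERIV_cmult)
    then show ?thesis by (simp add: mult_ac)
  qed
  have root: "\<bar>f''' (\<phi> t)\<bar> \<le> ((1 - t) * C + t * D) powr r" if "t \<in> {0..1}" for t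
  proof -
    have "(\<bar>f''' (\<phi> t)\<bar> powr q) powr r \<le> ((1 - t) * C + t * D) powr r"
      using bound[OF that] r by (intro powr_mono2) (auto simp: \<phi>_def d_def)
    then show ?thesis using \<open>q \<ge> 1\<close> by (simp add: powr_powr r_def)
  qed
  \<comment> \<open>The tangent is taken at the value \<open>c\<close> of the chord at the weighted mean point \<open>3 / 5\<close>. If
    \<open>c = 0\<close>, where the root need not have a tangent, then the chord and hence \<open>f'''\<close> vanish.\<close>
  define k where "k = c powr (r - 1)"
  have lin: "\<bar>f''' (\<phi> t)\<bar> \<le> k * (r * C + (1 - r) * c) + k * r * (D - C) * t"
    if t: "t \<in> {0..1}" for t
  proof (cases "c = 0")
    case True
    then have "C = 0" "D = 0" using \<open>C \<ge> 0\<close> \<open>D \<ge> 0\<close> by (auto simp: c_def)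
    then show ?thesis using root[OF t] r True by simp
  next
    case False
    then have "c > 0" using \<open>C \<ge> 0\<close> \<open>D \<ge> 0\<close> by (simp add: c_def less_le)
    have "((1 - t) * C + t * D) powr r \<le> k * (r * ((1 - t) * C + t * D) + (1 - r) * c)"
      unfolding k_def using t r \<open>c > 0\<close> \<open>C \<ge> 0\<close> \<open>D \<ge> 0\<close> by (intro powr_le_tangent) auto
    with root[OF t] show ?thesis by (simp add: algebra_simps)
  qed
  have kc: "k * c = c powr r"
    using \<open>C \<ge> 0\<close> \<open>D \<ge> 0\<close> by (simp add: k_def c_def flip: powr_mult_base) (simp add: powr_diff)
  have "\<bar>F (\<phi> 1) - F (\<phi> 0) - (2 / 3 * (d * f (\<phi> 1)) + 1 / 3 * (d * f (\<phi> 0)) - d\<^sup>2 * f' (\<phi> 1) / 6)\<bar>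
       \<le> d ^ 4 * (k * (r * C + (1 - r) * c)) / 72 + d ^ 4 * (k * r * (D - C)) / 120"
  proof (rule peano_kernel_bound[where G = "\<lambda>t. F (\<phi> t)" and g = "\<lambda>t. d * f (\<phi> t)"
        and g' = "\<lambda>t. d\<^sup>2 * f' (\<phi> t)" and g'' = "\<lambda>t. d ^ 3 * f'' (\<phi> t)"
        and g''' = "\<lambda>t. d ^ 4 * f''' (\<phi> t)"])
    fix t :: real assume t: "t \<in> {0..1}"
    show "((\<lambda>t. F (\<phi> t)) has_real_derivative d * f (\<phi> t)) (at t within {0..1})"
      using chain[OF F t, of 1] by simp
    show "((\<lambda>t. d * f (\<phi> t)) has_real_derivative d\<^sup>2 * f' (\<phi> t)) (at t within {0..1})"
      using chain[OF f t, of d] by (simp add: power2_eq_square)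
    show "((\<lambda>t. d\<^sup>2 * f' (\<phi> t)) has_real_derivative d ^ 3 * f'' (\<phi> t)) (at t within {0..1})"
      using chain[OF f' t, of "d\<^sup>2"] by (simp add: eval_nat_numeral mult_ac)
    show "((\<lambda>t. d ^ 3 * f'' (\<phi> t)) has_real_derivative d ^ 4 * f''' (\<phi> t)) (at t within {0..1})"
      using chain[OF f'' t, of "d ^ 3"] by (simp add: eval_nat_numeral mult_ac)
    have "\<bar>d ^ 4 * f''' (\<phi> t)\<bar> = d ^ 4 * \<bar>f''' (\<phi> t)\<bar>"
      by (simp add: abs_mult)
    also have "\<dots> \<le> d ^ 4 * (k * (r * C + (1 - r) * c) + k * r * (D - C) * t)"
      by (intro mult_left_mono lin t) simp
    finally show "\<bar>d ^ 4 * f''' (\<phi> t)\<bar>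
        \<le> d ^ 4 * (k * (r * C + (1 - r) * c)) + d ^ 4 * (k * r * (D - C)) * t"
      by (simp add: algebra_simps)
  qed
  also have "d ^ 4 * (k * (r * C + (1 - r) * c)) / 72 + d ^ 4 * (k * r * (D - C)) / 120
      = d ^ 4 / 72 * (k * c)"
    by (simp add: c_def field_simps)
  finally have "\<bar>F (\<phi> 1) - F (\<phi> 0) - (2 / 3 * (d * f (\<phi> 1)) + 1 / 3 * (d * f (\<phi> 0)) - d\<^sup>2 * f' (\<phi> 1) / 6)\<bar>
       \<le> d ^ 4 / 72 * c powr r"
    unfolding kc .
  moreover have "\<phi> 1 = w" "\<phi> 0 = e" by (simp_all add: \<phi>_def d_def)
  ultimately show ?thesis
    by (simp add: d_def c_def r_def distrib_left mult.left_commute)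
qed

text \<open>
  The two halves are taken from the endpoints towards the midpoint, where the chord has the value
  \<open>(A + B) / 2\<close>. Each half has length \<open>\<bar>v - u\<bar> / 2\<close>, and \<open>1152 = 72 * 2 ^ 4\<close>.
\<close>

lemma simpson_bound:
  fixes F f f' f'' f''' :: "real \<Rightarrow> real" and u v A B q :: real
  assumes F: "\<And>x. x \<in> closed_segment u v \<Longrightarrow> (F has_real_derivative f x) (at x within closed_segment u v)"
    and f: "\<And>x. x \<in> closed_segment u v \<Longrightarrow> (f has_real_derivative f' x) (at x within closed_segment u v)"
    and f': "\<And>x. x \<in> closed_segment u v \<Longrightarrow> (f' has_real_derivative f'' x) (at x within closed_segment u v)"
    and f'': "\<And>x. x \<in> closed_segment u v \<Longrightarrow> (f'' has_real_derivative f''' x) (at x within closed_segment u v)"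
    and "q \<ge> 1" "A \<ge> 0" "B \<ge> 0"
    and bound: "\<And>t. t \<in> {0..1} \<Longrightarrow> \<bar>f''' (t * u + (1 - t) * v)\<bar> powr q \<le> t * A + (1 - t) * B"
  shows "\<bar>F v - F u - (v - u) / 6 * (f u + 4 * f ((u + v) / 2) + f v)\<bar>
         \<le> (v - u) ^ 4 / 1152 *
             (((3 * A + 7 * B) / 10) powr (1 / q) + ((7 * A + 3 * B) / 10) powr (1 / q))"
proof -
  define w where "w = (u + v) / 2"
  have sub: "closed_segment u w \<subseteq> closed_segment u v" "closed_segment v w \<subseteq> closed_segment u v"
    by (auto simp: w_def closed_segment_eq_real_ivl)
  have left: "\<bar>F w - F u - ((w - u) * (2 / 3 * f w + 1 / 3 * f u) - (w - u)\<^sup>2 * f' w / 6)\<bar>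
         \<le> (w - u) ^ 4 / 72 * ((2 * A + 3 * ((A + B) / 2)) / 5) powr (1 / q)"
  proof (rule corrected_half_simpson_bound[where f'' = f'' and f''' = f'''])
    fix t :: real assume t: "t \<in> {0..1}"
    show "\<bar>f''' (u + (w - u) * t)\<bar> powr q \<le> (1 - t) * A + t * ((A + B) / 2)"
      using bound[of "1 - t / 2"] t by (simp add: w_def field_simps)
  qed (use assms(5-7) sub(1) in \<open>auto intro: DERIV_subset F f f' f''\<close>)
  have right: "\<bar>F w - F v - ((w - v) * (2 / 3 * f w + 1 / 3 * f v) - (w - v)\<^sup>2 * f' w / 6)\<bar>
         \<le> (w - v) ^ 4 / 72 * ((2 * B + 3 * ((A + B) / 2)) / 5) powr (1 / q)"
  proof (rule corrected_half_simpson_bound[where f'' = f'' and f''' = f'''])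
    fix t :: real assume t: "t \<in> {0..1}"
    show "\<bar>f''' (v + (w - v) * t)\<bar> powr q \<le> (1 - t) * B + t * ((A + B) / 2)"
      using bound[of "t / 2"] t by (simp add: w_def field_simps)
  qed (use assms(5-7) sub(2) in \<open>auto intro: DERIV_subset F f f' f''\<close>)
  define h where "h = v - u"
  have wh: "w - u = h / 2" "w - v = - (h / 2)" by (auto simp: w_def h_def field_simps)
  have AB: "(2 * A + 3 * ((A + B) / 2)) / 5 = (7 * A + 3 * B) / 10"
           "(2 * B + 3 * ((A + B) / 2)) / 5 = (3 * A + 7 * B) / 10" by (auto simp: field_simps)
  let ?l = "F w - F u - ((w - u) * (2 / 3 * f w + 1 / 3 * f u) - (w - u)\<^sup>2 * f' w / 6)"
  let ?r = "F w - F v - ((w - v) * (2 / 3 * f w + 1 / 3 * f v) - (w - v)\<^sup>2 * f' w / 6)"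
  have "F v - F u - h / 6 * (f u + 4 * f w + f v) = ?l - ?r"
    unfolding wh by (simp add: field_simps power2_eq_square)
  then have "\<bar>F v - F u - h / 6 * (f u + 4 * f w + f v)\<bar> \<le> \<bar>?l\<bar> + \<bar>?r\<bar>"
    by linarith
  also have "\<dots> \<le> (h / 2) ^ 4 / 72 * ((7 * A + 3 * B) / 10) powr (1 / q)
      + (h / 2) ^ 4 / 72 * ((3 * A + 7 * B) / 10) powr (1 / q)"
    using left right unfolding AB wh by simp
  finally show ?thesis by (simp add: h_def w_def field_simps)
qed

theorem theorem5:
  fixes I :: "real set" and f f' f'' f''' :: "real \<Rightarrow> real" and b_star a b m q :: real
  assumes "b_star > 0"
    and "is_interval I" and "I \<subseteq> {0..b_star}"
    and "a \<in> I" and "b \<in> I" and "a < b"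
    and "0 < m" and "m \<le> 1" and "m * b \<in> I"
    and "\<And>x. x \<in> interior I \<union> {a, b, m * b} \<Longrightarrow> (f has_real_derivative f' x) (at x within I)"
    and "\<And>x. x \<in> interior I \<union> {a, b, m * b} \<Longrightarrow> (f' has_real_derivative f'' x) (at x within I)"
    and "\<And>x. x \<in> interior I \<union> {a, b, m * b} \<Longrightarrow> (f'' has_real_derivative f''' x) (at x within I)"
    and "f''' absolutely_integrable_on {a..b}"
    and "q \<ge> 1"
    and "m_convex_on m {a..b} (\<lambda>x. \<bar>f''' x\<bar> powr q)"
  shows "\<bar>(LBINT x=a..m * b. f x)
            - (m * b - a) / 6 * (f a + 4 * f ((a + m * b) / 2) + f (m * b))\<bar>
         \<le> (m * b - a) ^ 4 / 1152 *
             (((3 * \<bar>f''' a\<bar> powr q + 7 * m * \<bar>f''' b\<bar> powr q) / 10) powr (1 / q)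
            + ((7 * \<bar>f''' a\<bar> powr q + 3 * m * \<bar>f''' b\<bar> powr q) / 10) powr (1 / q))"
proof -
  define S where "S = closed_segment a (m * b)"
  have S: "S = {min a (m * b)..max a (m * b)}"
    by (auto simp: S_def closed_segment_eq_real_ivl)
  have SI: "S \<subseteq> I"
    unfolding S_def using assms(2,4,9) by (simp add: closed_segment_subset is_interval_convex)
  have interior: "x \<in> interior I \<union> {a, b, m * b}" if "x \<in> S" for x
  proof (cases "x = a \<or> x = m * b")
    case False
    with that have "x \<in> {min a (m * b)<..<max a (m * b)}" by (auto simp: S)
    moreover have "{min a (m * b)<..<max a (m * b)} \<subseteq> interior I"
      using SI by (intro interior_maximal) (auto simp: S)
    ultimately show ?thesis by blast
  qed auto
  have f: "(f has_real_derivative f' x) (at x within S)"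
    and f': "(f' has_real_derivative f'' x) (at x within S)"
    and f'': "(f'' has_real_derivative f''' x) (at x within S)" if "x \<in> S" for x
    using interior[OF that] assms(10-12) SI by (blast intro: DERIV_subset)+
  have cont: "continuous_on S f"
    using f by (rule DERIV_continuous_on)
  obtain F where F: "\<And>x. x \<in> S \<Longrightarrow> (F has_vector_derivative f x) (at x within S)"
    using antiderivative_continuous cont unfolding S by blast
  have "(LBINT x=a..m * b. f x) = F (m * b) - F a"
    by (rule interval_integral_FTC_finite) (use cont F in \<open>simp_all add: S\<close>)
  moreover have "\<bar>F (m * b) - F a - (m * b - a) / 6 * (f a + 4 * f ((a + m * b) / 2) + f (m * b))\<bar>
         \<le> (m * b - a) ^ 4 / 1152 *
             (((3 * \<bar>f''' a\<bar> powr q + 7 * (m * \<bar>f''' b\<bar> powr q)) / 10) powr (1 / q)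
            + ((7 * \<bar>f''' a\<bar> powr q + 3 * (m * \<bar>f''' b\<bar> powr q)) / 10) powr (1 / q))"
  proof (rule simpson_bound[where f'' = f'' and f''' = f'''])
    fix t :: real assume "t \<in> {0..1}"
    then have "\<bar>f''' (t * a + m * (1 - t) * b)\<bar> powr q
        \<le> t * \<bar>f''' a\<bar> powr q + m * (1 - t) * \<bar>f''' b\<bar> powr q"
      using assms(6,15) unfolding m_convex_on_def by auto
    then show "\<bar>f''' (t * a + (1 - t) * (m * b))\<bar> powr q
        \<le> t * \<bar>f''' a\<bar> powr q + (1 - t) * (m * \<bar>f''' b\<bar> powr q)"
      by (simp add: mult_ac)
  qed (use F f f' f'' assms(7,14) in
      \<open>auto simp: S_def has_real_derivative_iff_has_vector_derivative\<close>)
  ultimately show ?thesis by (simp add: mult.assoc)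
qed

end
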